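(* Let $A\in\mathbb{R}^{m\times p}$, $B\in\mathbb{R}^{q\times n}$ and $C\in\mathbb{R}^{m\times n}$ be such that the matrix equation $AXB=C$ is consistent, and let $\theta\in(0,1)$. Assume that $0<\alpha<\frac{2}{\|B\|_2^2}$. Let $\{X^k\}_{k=0}^\infty$ be the sequence generated by the ME-RGRBK method with relaxation factor $\theta$ (described in the context) from an initial matrix $X^0\in\mathbb{R}^{p\times q}$ with $\mathrm{vec}(X^0)\in R(B\otimes A^T)$. Then $\{X^k\}$ converges in expectation to the unique least-norm solution $X_*=A^+CB^+$ of $AXB=C$. Moreover, $$E\left[\|X^1-X_*\|_F^2\right]\le\left(1-\frac{(2\alpha-\alpha^2\|B\|_2^2)\|B\|_F^2}{\kappa_{F,2}^2(B^T\otimes A)}\right)\|X^0-X_*\|_F^2,$$ and, for $k=1,2,\ldots$, $$E_k\left[\|X^{k+1}-X_*\|_F^2\right]\le\left(1-\frac{(2\alpha-\alpha^2\|B\|_2^2)\phi_k}{\kappa_{F,2}^2(B^T\otimes A)}\right)\|X^k-X_*\|_F^2,$$ where $\phi_k=\frac{\theta\|B^T\otimes A\|_F^2}{\gamma_k}+(1-\theta)\|B\|_F^2$, $\gamma_k=\|A\|_F^2-\sum_{i\in\Omega_k}\|A_{i,:}\|_2^2$ and $\Omega_k=\{i\in[m] : \|R^k_{i,:}\|_2^2=0\}$. As a result, $$E\left[\|X^{k+1}-X_*\|_F^2\right]\le\prod_{l=0}^{k}\rho_{l,\theta}\,\|X^0-X_*\|_F^2,$$ where $\rho_{0,\theta}=1-\frac{(2\alpha-\alpha^2\|B\|_2^2)\|B\|_F^2}{\kappa_{F,2}^2(B^T\otimes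 A)}$ and $\rho_{l,\theta}=1-\frac{(2\alpha-\alpha^2\|B\|_2^2)\phi_l}{\kappa_{F,2}^2(B^T\otimes A)}$ for $l=1,2,\ldots,k$.
   Context: Notation: for a real matrix $M$, $M^T$ is the transpose, $M^+$ the Moore–Penrose inverse, $R(M)$ the range (column space), $\|M\|_2$ the spectral norm (Euclidean norm for vectors), $\|M\|_F$ the Frobenius norm, $M_{i,:}$ the $i$-th row; $\otimes$ is the Kronecker product; $\mathrm{vec}(\cdot)$ stacks the columns of a matrix; $[m]=\{1,\ldots,m\}$; $\kappa_{F,2}(M):=\|M\|_F\|M^+\|_2$. The least-norm solution is the solution of $AXB=C$ of minimal Frobenius norm. All rows of $A$ are nonzero and $B\ne0$. ME-RGRBK method with relaxation factor $\theta\in(0,1)$: given $X^0$, put $R^0=C-AX^0B$. For $k=0,1,2,\ldots$ until convergence: (1) $\xi_k=\frac{\theta}{\|R^k\|_F^2}\max_{1\le i\le m}\left(\frac{\|R^k_{i,:}\|_2^2}{\|A_{i,:}\|_2^2}\right)+\frac{1-\theta}{\|A\|_F^2}$; (2) $\mathcal{H}_k=\{i\in[m] : \|R^k_{i,:}\|_2^2\ge\xi_k\|A_{i,:}\|_2^2\|R^k\|_F^2\}$; (3) $\widetilde R^k$ is the matrix with rows $\widetilde R^k_{i,:}=R^k_{i,:}$ if $i\in\mathcal{H}_k$ and $\widetilde R^k_{i,:}=0$ otherwise; (4) choose $i_k\in\mathcal{H}_k$ at random, the index $i$ being chosen (conditionally on the past) with probability $\|\widetilde R^k_{i,:}\|_2^2/\|\widetilde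 R^k\|_F^2$; (5) $X^{k+1}=X^k+\frac{\alpha}{\|A_{i_k,:}\|_2^2}A_{i_k,:}^TR^k_{i_k,:}B^T$; (6) $R^{k+1}=R^k-\frac{\alpha}{\|A_{i_k,:}\|_2^2}(AA^T)_{:,i_k}R^k_{i_k,:}B^TB$ (so that $R^k=C-AX^kB$ for all $k$), where $(AA^T)_{:,i_k}$ is the $i_k$-th column of $AA^T$. $E_k[\cdot]=E[\cdot\mid i_0,i_1,\ldots,i_{k-1}]$ is the expectation conditional on the first $k$ iterations, where $i_s$ is the row index selected at iteration $s$. Convergence in expectation to $X_*$ means $E[\|X^k-X_*\|_F^2]\to0$. The iteration stops once $R^k=0$ (the sequence is then taken constant from that point on); the quantities $\xi_k,\gamma_k,\phi_k$ and the bounds involving them are understood for iterations with $R^k\ne0$.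
   Formalization: In the last bound the factors ρ_l (l≥1) depend on the random rows drawn; read along a single run the bound can fail. The formal statement bounds E‖X^{k+1}−X_*‖² by the expectation of the product of the ρ_l over runs with R^k≠0, times ‖X^0−X_*‖². *)

theory Defs
  imports "HOL-Probability.Probability"
begin

text \<open>
  An $m \times n$ matrix is a \<^typ>\<open>real ^ 'n ^ 'm\<close>, so that \<open>M $ i\<close> is its \<open>i\<close>-th row.
  The library norm on this type is the Frobenius norm:
\<close>

lemma norm_matrix_frobenius:
  fixes M :: "real ^ 'n ^ 'm"
  shows "norm M = sqrt (\<Sum>i\<in>UNIV. \<Sum>j\<in>UNIV. (M $ i $ j)\<^sup>2)"
  by (simp add: norm_vec_def L2_set_def sum_nonneg)

definition spectral_norm :: "real ^ 'n ^ 'm \<Rightarrow> real" where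
  "spectral_norm M = onorm (\<lambda>x. M *v x)"

definition mat_range :: "real ^ 'n ^ 'm \<Rightarrow> (real ^ 'm) set" where
  "mat_range M = range (\<lambda>x. M *v x)"

text \<open>The Moore--Penrose inverse, as the unique solution of the four Penrose equations.\<close>

definition is_pinv :: "real ^ 'n ^ 'm \<Rightarrow> real ^ 'm ^ 'n \<Rightarrow> bool" where
  "is_pinv M G \<longleftrightarrow>
     M ** G ** M = M \<and> G ** M ** G = G \<and>
     transpose (M ** G) = M ** G \<and> transpose (G ** M) = G ** M"

lemma is_pinv_unique:
  assumes "is_pinv M G" "is_pinv M H"
  shows "G = H"
proof -
  have MG: "M ** G = M ** H"
  proof -
    have "M ** G = transpose (M ** G)" using assms by (simp add: is_pinv_def)
    also have "\<dots> = transpose ((M ** H) ** (M ** G))"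
      using assms by (simp add: is_pinv_def matrix_mul_assoc)
    also have "\<dots> = transpose (M ** G) ** transpose (M ** H)"
      by (rule matrix_transpose_mul)
    also have "\<dots> = (M ** G) ** (M ** H)" using assms by (simp add: is_pinv_def)
    also have "\<dots> = M ** H" using assms by (simp add: is_pinv_def matrix_mul_assoc)
    finally show ?thesis .
  qed
  have GM: "G ** M = H ** M"
  proof -
    have "G ** M = transpose (G ** M)" using assms by (simp add: is_pinv_def)
    also have "\<dots> = transpose ((G ** M) ** (H ** M))"
      using assms by (metis is_pinv_def matrix_mul_assoc)
    also have "\<dots> = transpose (H ** M) ** transpose (G ** M)"
      by (rule matrix_transpose_mul)
    also have "\<dots> = (H ** M) ** (G ** M)" using assms by (simp add: is_pinv_def)
    also have "\<dots> = H ** M" using assms by (metis is_pinv_def matrix_mul_assoc)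
    finally show ?thesis .
  qed
  have "G = (G ** M) ** G" using assms by (simp add: is_pinv_def)
  also have "\<dots> = H ** (M ** G)" by (simp add: GM matrix_mul_assoc)
  also have "\<dots> = H" using assms by (simp add: MG is_pinv_def matrix_mul_assoc)
  finally show ?thesis .
qed

definition pinv :: "real ^ 'n ^ 'm \<Rightarrow> real ^ 'm ^ 'n" where
  "pinv M = (THE G. is_pinv M G)"

definition kappa_F2 :: "real ^ 'n ^ 'm \<Rightarrow> real" where
  "kappa_F2 M = norm M * spectral_norm (pinv M)"

text \<open>
  Kronecker products and vectorizations are indexed by pairs.  In \<open>vec_cols X\<close> the index is
  (column, row): this is stacking the columns, with the order of the entries left implicit.
\<close>

definition kron :: "real ^ 'b ^ 'a \<Rightarrow> real ^ 'd ^ 'c \<Rightarrow> real ^ ('b \<times> 'd) ^ ('a \<times> 'c)" where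
  "kron M N = (\<chi> r. \<chi> s. M $ fst r $ fst s * N $ snd r $ snd s)"

definition vec_cols :: "real ^ 'q ^ 'p \<Rightarrow> real ^ ('q \<times> 'p)" where
  "vec_cols X = (\<chi> s. X $ snd s $ fst s)"

lemma kron_vec_cols:
  fixes A :: "real ^ 'p ^ 'm" and X :: "real ^ 'q ^ 'p" and B :: "real ^ 'n ^ 'q"
  shows "kron (transpose B) A *v vec_cols X = vec_cols (A ** X ** B)"
proof -
  have "(\<Sum>s\<in>UNIV. B $ fst s $ j * A $ i $ snd s * X $ snd s $ fst s)
      = (\<Sum>k\<in>UNIV. (\<Sum>l\<in>UNIV. A $ i $ l * X $ l $ k) * B $ k $ j)" for i j
  proof -
    have "(\<Sum>s\<in>UNIV. B $ fst s $ j * A $ i $ snd s * X $ snd s $ fst s)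
        = (\<Sum>k\<in>UNIV. \<Sum>l\<in>UNIV. B $ k $ j * A $ i $ l * X $ l $ k)"
      by (subst UNIV_Times_UNIV[symmetric], subst sum.cartesian_product) (simp add: case_prod_beta)
    then show ?thesis
      by (simp add: sum_distrib_left sum_distrib_right mult_ac)
  qed
  then show ?thesis
    by (simp add: vec_eq_iff kron_def vec_cols_def matrix_vector_mult_def matrix_matrix_mult_def
        transpose_def)
qed

definition outer :: "real ^ 'm \<Rightarrow> real ^ 'n \<Rightarrow> real ^ 'n ^ 'm" where
  "outer u v = (\<chi> i. \<chi> j. u $ i * v $ j)"

definition least_norm_solution ::
    "real ^ 'p ^ 'm \<Rightarrow> real ^ 'n ^ 'q \<Rightarrow> real ^ 'n ^ 'm \<Rightarrow> real ^ 'q ^ 'p \<Rightarrow> bool" where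
  "least_norm_solution A B C X \<longleftrightarrow>
     A ** X ** B = C \<and> (\<forall>Y. A ** Y ** B = C \<longrightarrow> norm X \<le> norm Y)"

definition xi :: "real ^ 'p ^ 'm \<Rightarrow> real \<Rightarrow> real ^ 'n ^ 'm \<Rightarrow> real" where
  "xi A \<theta> R =
     \<theta> / (norm R)\<^sup>2 * Max (range (\<lambda>i. (norm (R $ i))\<^sup>2 / (norm (A $ i))\<^sup>2))
       + (1 - \<theta>) / (norm A)\<^sup>2"

definition index_set :: "real ^ 'p ^ 'm \<Rightarrow> real \<Rightarrow> real ^ 'n ^ 'm \<Rightarrow> 'm set" where
  "index_set A \<theta> R = {i. (norm (R $ i))\<^sup>2 \<ge> xi A \<theta> R * (norm (A $ i))\<^sup>2 * (norm R)\<^sup>2}"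

definition trunc_residual :: "real ^ 'p ^ 'm \<Rightarrow> real \<Rightarrow> real ^ 'n ^ 'm \<Rightarrow> real ^ 'n ^ 'm" where
  "trunc_residual A \<theta> R = (\<chi> i. if i \<in> index_set A \<theta> R then R $ i else 0)"

text \<open>This vanishes outside \<open>index_set A \<theta> R\<close>, so it also encodes that the selected row lies there.\<close>

definition select_prob :: "real ^ 'p ^ 'm \<Rightarrow> real \<Rightarrow> real ^ 'n ^ 'm \<Rightarrow> 'm \<Rightarrow> real" where
  "select_prob A \<theta> R i =
     (norm (trunc_residual A \<theta> R $ i))\<^sup>2 / (norm (trunc_residual A \<theta> R))\<^sup>2"

text \<open>The sigma-algebra generated by $i_0, \dots, i_{k-1}$ (trivial for $k = 0$).\<close>

definition past :: "'a measure \<Rightarrow> (nat \<Rightarrow> 'a \<Rightarrow> 'm) \<Rightarrow> nat \<Rightarrow> 'a measure" where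
  "past M I k = sigma (space M) {I s -` {i} \<inter> space M | s i. s < k}"

text \<open>
  \<open>I k\<close> is the row index drawn in iteration \<open>k\<close>.  Once the residual is zero, the law of \<open>I k\<close>
  is left unconstrained; both updates are then zero whichever row is drawn, so the iteration
  stays constant, as it should after stopping.
\<close>

definition me_rgrbk ::
    "real ^ 'p ^ 'm \<Rightarrow> real ^ 'n ^ 'q \<Rightarrow> real ^ 'n ^ 'm \<Rightarrow> real \<Rightarrow> real \<Rightarrow> real ^ 'q ^ 'p \<Rightarrow>
     'a measure \<Rightarrow> (nat \<Rightarrow> 'a \<Rightarrow> 'm) \<Rightarrow> (nat \<Rightarrow> 'a \<Rightarrow> real ^ 'q ^ 'p) \<Rightarrow>
     (nat \<Rightarrow> 'a \<Rightarrow> real ^ 'n ^ 'm) \<Rightarrow> bool" where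
  "me_rgrbk A B C \<alpha> \<theta> X0 M I X R \<longleftrightarrow>
     prob_space M \<and>
     (\<forall>k. I k \<in> measurable M (count_space UNIV)) \<and>
     (\<forall>\<omega>\<in>space M. X 0 \<omega> = X0 \<and> R 0 \<omega> = C - A ** X0 ** B) \<and>
     (\<forall>k. \<forall>i. AE \<omega> in M. R k \<omega> \<noteq> 0 \<longrightarrow>
        real_cond_exp M (past M I k) (indicator {\<omega> \<in> space M. I k \<omega> = i}) \<omega>
          = select_prob A \<theta> (R k \<omega>) i) \<and>
     (\<forall>k. \<forall>\<omega>\<in>space M. let i = I k \<omega>; c = \<alpha> / (norm (A $ i))\<^sup>2 in
        X (Suc k) \<omega> = X k \<omega> + c *\<^sub>R outer (A $ i) (R k \<omega> $ i v* transpose B) \<and>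
        R (Suc k) \<omega> = R k \<omega> - c *\<^sub>R outer (column i (A ** transpose A))
                                         (R k \<omega> $ i v* (transpose B ** B)))"

definition zero_rows :: "real ^ 'n ^ 'm \<Rightarrow> 'm set" where
  "zero_rows R = {i. (norm (R $ i))\<^sup>2 = 0}"

definition gam :: "real ^ 'p ^ 'm \<Rightarrow> real ^ 'n ^ 'm \<Rightarrow> real" where
  "gam A R = (norm A)\<^sup>2 - (\<Sum>i\<in>zero_rows R. (norm (A $ i))\<^sup>2)"

definition phi ::
    "real ^ 'p ^ 'm \<Rightarrow> real ^ 'n ^ 'q \<Rightarrow> real \<Rightarrow> real ^ 'n ^ 'm \<Rightarrow> real" where
  "phi A B \<theta> R =
     \<theta> * (norm (kron (transpose B) A))\<^sup>2 / gam A R + (1 - \<theta>) * (norm B)\<^sup>2"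

definition rho0 :: "real ^ 'p ^ 'm \<Rightarrow> real ^ 'n ^ 'q \<Rightarrow> real \<Rightarrow> real" where
  "rho0 A B \<alpha> =
     1 - (2 * \<alpha> - \<alpha>\<^sup>2 * (spectral_norm B)\<^sup>2) * (norm B)\<^sup>2
           / (kappa_F2 (kron (transpose B) A))\<^sup>2"

text \<open>
  The factor of an iteration \<open>l \<ge> 1\<close> with residual \<open>R\<close>; meaningful for \<open>R \<noteq> 0\<close> only, since
  \<open>gam A 0 = 0\<close>.
\<close>

definition rho ::
    "real ^ 'p ^ 'm \<Rightarrow> real ^ 'n ^ 'q \<Rightarrow> real \<Rightarrow> real \<Rightarrow> real ^ 'n ^ 'm \<Rightarrow> real" where
  "rho A B \<alpha> \<theta> R =
     1 - (2 * \<alpha> - \<alpha>\<^sup>2 * (spectral_norm B)\<^sup>2) * phi A B \<theta> R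
           / (kappa_F2 (kron (transpose B) A))\<^sup>2"

text \<open>
  The product $\prod_{l=0}^{k} \rho_{l,\theta}$ along a realization \<open>r\<close> of the residuals.
  It depends on the rows drawn, so a bound on an unconditional expectation has to average it;
  realizations that have stopped by iteration \<open>k\<close> contribute nothing to the average, the error
  being zero from then on.
\<close>

definition rho_prod ::
    "real ^ 'p ^ 'm \<Rightarrow> real ^ 'n ^ 'q \<Rightarrow> real \<Rightarrow> real \<Rightarrow> (nat \<Rightarrow> real ^ 'n ^ 'm) \<Rightarrow> nat \<Rightarrow> real" where
  "rho_prod A B \<alpha> \<theta> r k =
     (\<Prod>l=0..k. if l = 0 then rho0 A B \<alpha> else rho A B \<alpha> \<theta> (r l))"

end

theory Submission
  imports Defs
begin

text \<open>
  Every row of \<open>index_set\<close>, not merely the average row, satisfies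
  $\|R_i\|^2/\|A_i\|^2 \ge (\theta/\gamma + (1-\theta)/\|A\|_F^2)\|R\|_F^2$.  The error stays in the
  row space of $B^T \otimes A$, where $\|E\|_F \le \|(B^T \otimes A)^+\|_2 \|AEB\|_F$, so the
  contraction by $\rho_k$ holds along almost every realization and not only in conditional
  expectation.  This is what makes the bound by the averaged product possible although the factors
  $\rho_k$ are random and may be correlated with the error.
\<close>

subsection \<open>Moore--Penrose inverses and Kronecker products\<close>

text \<open>Multiplying the pathwise bounds requires nonnegative factors, and the sign of
  \<open>rho\<close> is not evident from its formula. No singular value estimate is made for it:
  while the residual is nonzero the error is positive, so 0 \<le> \<open>err (Suc k)\<close> \<le>
  \<open>rho\<close> * \<open>err k\<close> already forces it. A zero residual is a separate case,
  because \<open>gam\<close> is then 0 and the factor has no meaning. On the row space, AEB = 0 only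
  for E = 0, so a zero residual means a zero error, and both persist. The start is deterministic and
  there are finitely many rows. Every quantity of iteration k therefore takes finitely many values,
  and simple functions supply both measurability and integrability. Convergence rests on the
  deterministic factor \<open>rho0\<close>, which is what \<open>rho\<close> becomes when
  \<open>gam\<close> is replaced by its upper bound ||A||_F^2.\<close>

lemma normal_equations_solvable:
  fixes M :: "real ^ 'n ^ 'm"
  shows "\<exists>Z. transpose M ** M ** Z = transpose M"
proof -
  have "\<exists>z. (transpose M ** M) *v z = column i (transpose M)" for i
  proof -
    \<comment> \<open>\<open>y\<close> is the orthogonal projection of the basis vector onto the
      column space of \<open>M\<close>. The remainder \<open>u\<close> is orthogonal to that space,
      hence killed by M^T, so a preimage of \<open>y\<close> solves the normal equations for this
      column.\<close>
    obtain y u where y: "y \<in> span (range ((*v) M))"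
      and u: "\<And>w. w \<in> span (range ((*v) M)) \<Longrightarrow> orthogonal u w" and yu: "axis i 1 = y + u"
      using orthogonal_subspace_decomp_exists by blast
    have "subspace (range ((*v) M))"
      by (rule linear_subspace_image) auto
    then obtain z where z: "y = M *v z"
      using y by (metis imageE span_eq_iff)
    have "inner w (transpose M *v u) = 0" for w
    proof -
      have "inner u (M *v w) = 0"
        using u[of "M *v w"] by (simp add: orthogonal_def span_base)
      then show ?thesis by (simp add: dot_lmul_matrix inner_commute[of w])
    qed
    then have "transpose M *v u = 0" by (metis inner_eq_zero_iff)
    then have "transpose M *v axis i 1 = transpose M *v (M *v z)"
      by (simp add: yu z matrix_vector_right_distrib del: transpose_matrix_vector)
    then show ?thesis
      by (metis matrix_vector_mul_assoc matrix_vector_mult_basis)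
  qed
  then obtain z where z: "\<And>i. (transpose M ** M) *v z i = column i (transpose M)"
    by metis
  have "N ** transpose (\<chi> i. z i) = (\<chi> a i. (N *v z i) $ a)" for N :: "real ^ 'n ^ 'n"
    by (simp add: vec_eq_iff matrix_matrix_mult_def matrix_vector_mult_def transpose_def)
  then have "transpose M ** M ** transpose (\<chi> i. z i) = (\<chi> a i. column i (transpose M) $ a)"
    by (simp only: z)
  also have "\<dots> = transpose M"
    by (simp add: vec_eq_iff column_def)
  finally show ?thesis by blast
qed

text \<open>Existence, which the description operator in \<open>pinv\<close> presupposes. The normal
  equations for M and for M^T give a right factor Z with MZ symmetric and MZM = M, and a left factor
  V with VM symmetric and MVM = M. Then VMZ satisfies all four Penrose equations, since M(VMZ) = MZ
  and (VMZ)M = VM.\<close>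

lemma is_pinv_pinv: "is_pinv M (pinv M)"
proof -
  obtain Z where Z: "transpose M ** M ** Z = transpose M"
    using normal_equations_solvable by blast
  obtain W where W: "M ** transpose M ** W = M"
    using normal_equations_solvable[of "transpose M"] by auto
  let ?V = "transpose W"
  have ZM: "transpose Z ** transpose M ** M = M"
    using arg_cong[OF Z, of transpose] by (simp add: matrix_transpose_mul matrix_mul_assoc)
  have VM: "?V ** M ** transpose M = transpose M"
    using arg_cong[OF W, of transpose] by (simp add: matrix_transpose_mul matrix_mul_assoc)
  have sZ: "transpose (M ** Z) = M ** Z"
  proof -
    have "M ** Z = transpose Z ** (transpose M ** M ** Z)"
      by (simp add: ZM matrix_mul_assoc)
    then show ?thesis by (simp add: Z matrix_transpose_mul)
  qed
  have sV: "transpose (?V ** M) = ?V ** M"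
  proof -
    have "?V ** M = ?V ** (M ** transpose M ** W)"
      by (simp add: W)
    then have "?V ** M = transpose M ** W" by (simp add: VM matrix_mul_assoc)
    then show ?thesis by (simp add: matrix_transpose_mul)
  qed
  have MZM: "M ** Z ** M = M"
    using sZ ZM by (simp add: matrix_transpose_mul)
  have MVM: "M ** ?V ** M = M"
    by (metis sV W matrix_transpose_mul matrix_mul_assoc transpose_transpose)
  let ?G = "?V ** M ** Z"
  have "M ** ?G = M ** Z" by (simp add: matrix_mul_assoc MVM)
  moreover have "?G ** M = ?V ** M" by (metis matrix_mul_assoc MZM)
  ultimately have "is_pinv M ?G"
    unfolding is_pinv_def using MZM sV sZ MVM by (metis matrix_mul_assoc)
  then show ?thesis
    unfolding pinv_def by (rule theI) (rule is_pinv_unique[OF _ \<open>is_pinv M ?G\<close>])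
qed

text \<open>In G = GMG either symmetric product can be transposed, which moves M^T to the outside.
  This is what places A^+ C B^+ in the range of the adjoint of X -> AXB.\<close>

lemma pinv_eq_transpose_mul: "\<exists>W. pinv M = transpose M ** W"
  and pinv_eq_mul_transpose: "\<exists>W. pinv M = W ** transpose M"
proof -
  have "pinv M = transpose (pinv M ** M) ** pinv M" "pinv M = pinv M ** transpose (M ** pinv M)"
    using is_pinv_pinv[of M] by (auto simp: is_pinv_def matrix_mul_assoc)
  then show "\<exists>W. pinv M = transpose M ** W" "\<exists>W. pinv M = W ** transpose M"
    by (metis matrix_transpose_mul matrix_mul_assoc)+
qed

lemma pinv_mul_self_row_space: "pinv M *v (M *v (transpose M *v y)) = transpose M *v y"
proof -
  have "pinv M ** M ** transpose M = transpose (pinv M ** M) ** transpose M"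
    using is_pinv_pinv[of M] by (simp add: is_pinv_def)
  also have "\<dots> = transpose (M ** pinv M ** M)"
    by (simp only: matrix_transpose_mul matrix_mul_assoc)
  also have "\<dots> = transpose M"
    using is_pinv_pinv[of M] by (simp add: is_pinv_def)
  finally show ?thesis
    by (metis matrix_vector_mul_assoc)
qed

section \<open>Spectral norm estimates\<close>

lemma norm_matrix_vector_le: "norm (M *v x) \<le> spectral_norm M * norm x"
  unfolding spectral_norm_def by (rule onorm) auto

lemma spectral_norm_nonneg: "0 \<le> spectral_norm M"
  unfolding spectral_norm_def by (rule onorm_pos_le) auto

lemma spectral_norm_pos:
  assumes "M \<noteq> 0" shows "0 < spectral_norm M"
proof -
  have "spectral_norm M \<noteq> 0"
  proof
    assume "spectral_norm M = 0"
    then have "M *v x = 0 *v x" for x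
      using norm_matrix_vector_le[of M x] by simp
    then show False using assms by (metis matrix_eq)
  qed
  then show ?thesis using spectral_norm_nonneg[of M] by simp
qed

lemma pinv_nonzero:
  assumes "M \<noteq> 0" shows "pinv M \<noteq> 0"
  using assms is_pinv_pinv[of M] by (auto simp: is_pinv_def)

text \<open>M^+ inverts M on its row space. This replaces the usual bound by the smallest nonzero
  singular value, whose reciprocal is ||M^+||_2 for nonzero M.\<close>

lemma norm_le_pinv_mul:
  assumes "x \<in> mat_range (transpose M)"
  shows "norm x \<le> spectral_norm (pinv M) * norm (M *v x)"
  using assms norm_matrix_vector_le[of "pinv M"] pinv_mul_self_row_space[of M]
  by (metis (mono_tags) mat_range_def image_iff)

section \<open>Frobenius norm, Kronecker products and vectorization\<close>

lemma norm_sq_rows: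
  fixes M :: "real ^ 'n ^ 'm"
  shows "(norm M)\<^sup>2 = (\<Sum>i\<in>UNIV. (norm (M $ i))\<^sup>2)"
  by (simp add: norm_vec_def L2_set_def sum_nonneg)

lemma transpose_kron: "transpose (kron M N) = kron (transpose M) (transpose N)"
  by (simp add: vec_eq_iff kron_def transpose_def)

lemma norm_kron: "norm (kron M N) = norm M * norm N"
proof -
  have s: "(\<Sum>r\<in>UNIV. f (fst r) * g (snd r)) = (\<Sum>a\<in>UNIV. f a) * (\<Sum>b\<in>UNIV. g b :: real)"
    for f :: "'x::finite \<Rightarrow> real" and g :: "'y::finite \<Rightarrow> real"
    by (simp add: sum_product sum.cartesian_product case_prod_beta flip: UNIV_Times_UNIV)
  have "(\<Sum>r\<in>UNIV. \<Sum>t\<in>UNIV. (kron M N $ r $ t)\<^sup>2)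
      = (\<Sum>r\<in>UNIV. (\<Sum>j\<in>UNIV. (M $ fst r $ j)\<^sup>2) * (\<Sum>j\<in>UNIV. (N $ snd r $ j)\<^sup>2))"
    by (simp add: kron_def power_mult_distrib
        s[of "\<lambda>j. (M $ a $ j)\<^sup>2" "\<lambda>j. (N $ b $ j)\<^sup>2" for a b])
  also have "\<dots> = (\<Sum>i\<in>UNIV. \<Sum>j\<in>UNIV. (M $ i $ j)\<^sup>2) * (\<Sum>i\<in>UNIV. \<Sum>j\<in>UNIV. (N $ i $ j)\<^sup>2)"
    by (rule s)
  finally show ?thesis by (simp add: norm_matrix_frobenius real_sqrt_mult)
qed

lemma norm_vec_cols: "norm (vec_cols X) = norm X"
proof -
  have "(\<Sum>s\<in>UNIV. (X $ snd s $ fst s)\<^sup>2) = (\<Sum>a\<in>UNIV. \<Sum>b\<in>UNIV. (X $ b $ a)\<^sup>2)"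
    by (simp add: sum.cartesian_product case_prod_beta flip: UNIV_Times_UNIV)
  also have "\<dots> = (\<Sum>b\<in>UNIV. \<Sum>a\<in>UNIV. (X $ b $ a)\<^sup>2)" by (rule sum.swap)
  finally have "(norm (vec_cols X))\<^sup>2 = (norm X)\<^sup>2"
    by (simp add: norm_sq_rows[of X] power2_norm_eq_inner inner_vec_def vec_cols_def
        flip: power2_eq_square)
  then show ?thesis by simp
qed

lemma inj_vec_cols: "vec_cols X = vec_cols Y \<Longrightarrow> X = Y"
  by (simp add: vec_cols_def vec_eq_iff)

lemma vec_cols_surj: "\<exists>X. vec_cols X = v"
  by (rule exI[of _ "\<chi> i j. v $ (j, i)"]) (simp add: vec_cols_def vec_eq_iff)

text \<open>The range of the adjoint of X -> AXB. Under \<open>vec_cols\<close> it becomes the range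
  of \<open>kron B (transpose A)\<close>, the transpose of \<open>kron (transpose B) A\<close>, and
  so the row space used in the error bound. In matrix form, the row steps are visibly members of
  it.\<close>

definition sandwich_range :: "real ^ 'p ^ 'm \<Rightarrow> real ^ 'n ^ 'q \<Rightarrow> (real ^ 'q ^ 'p) set" where
  "sandwich_range A B = range (\<lambda>Y. transpose A ** Y ** transpose B)"

lemma vec_cols_in_kron_range_iff:
  "vec_cols X \<in> mat_range (kron B (transpose A)) \<longleftrightarrow> X \<in> sandwich_range A B"
proof -
  have k: "kron B (transpose A) *v vec_cols Y = vec_cols (transpose A ** Y ** transpose B)" for Y
    using kron_vec_cols[of "transpose B" "transpose A" Y] by simp
  have "vec_cols X \<in> mat_range (kron B (transpose A))
      \<longleftrightarrow> (\<exists>Y. vec_cols X = kron B (transpose A) *v vec_cols Y)"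
    unfolding mat_range_def image_iff by (metis vec_cols_surj UNIV_I)
  also have "\<dots> \<longleftrightarrow> (\<exists>Y. X = transpose A ** Y ** transpose B)"
    unfolding k by (metis inj_vec_cols)
  finally show ?thesis by (auto simp: sandwich_range_def)
qed

lemma linear_sandwich: "linear (\<lambda>X. A ** X ** (B :: real ^ _ ^ _))"
proof (rule linearI)
  show "A ** (X + Y) ** B = A ** X ** B + A ** Y ** B" for X Y
    unfolding matrix_add_ldistrib
    by (simp add: vec_eq_iff matrix_matrix_mult_def sum.distrib distrib_right)
  show "A ** (c *\<^sub>R X) ** B = c *\<^sub>R (A ** X ** B)" for c X
    by (simp add: matrix_scalar_ac scalar_matrix_assoc)
qed

lemma subspace_sandwich_range: "subspace (sandwich_range A B)"
  unfolding sandwich_range_def by (rule linear_subspace_image[OF linear_sandwich subspace_UNIV])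

lemma norm_le_sandwich:
  assumes "E \<in> sandwich_range A B"
  shows "norm E \<le> spectral_norm (pinv (kron (transpose B) A)) * norm (A ** E ** B)"
proof -
  have "vec_cols E \<in> mat_range (transpose (kron (transpose B) A))"
    using assms by (simp add: transpose_kron vec_cols_in_kron_range_iff)
  from norm_le_pinv_mul[OF this] show ?thesis
    by (simp add: kron_vec_cols norm_vec_cols)
qed

section \<open>Frobenius adjoint and least-norm solutions\<close>

lemma inner_matrix_mul_left: "inner (A ** X) W = inner X (transpose A ** (W :: real ^ _ ^ _))"
proof -
  have "inner (A ** X) W = (\<Sum>i\<in>UNIV. \<Sum>j\<in>UNIV. \<Sum>k\<in>UNIV. A $ i $ k * X $ k $ j * W $ i $ j)"
    by (simp add: inner_vec_def matrix_matrix_mult_def sum_distrib_right)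
  also have "\<dots> = (\<Sum>i\<in>UNIV. \<Sum>k\<in>UNIV. \<Sum>j\<in>UNIV. A $ i $ k * X $ k $ j * W $ i $ j)"
    by (rule sum.cong[OF refl], rule sum.swap)
  also have "\<dots> = (\<Sum>k\<in>UNIV. \<Sum>i\<in>UNIV. \<Sum>j\<in>UNIV. A $ i $ k * X $ k $ j * W $ i $ j)"
    by (rule sum.swap)
  also have "\<dots> = (\<Sum>k\<in>UNIV. \<Sum>j\<in>UNIV. \<Sum>i\<in>UNIV. A $ i $ k * X $ k $ j * W $ i $ j)"
    by (rule sum.cong[OF refl], rule sum.swap)
  also have "\<dots> = inner X (transpose A ** W)"
    by (simp add: inner_vec_def matrix_matrix_mult_def transpose_def sum_distrib_left mult_ac)
  finally show ?thesis .
qed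

lemma inner_transpose: "inner (transpose X) (transpose Y) = inner X (Y :: real ^ _ ^ _)"
  by (simp add: inner_vec_def transpose_def, rule sum.swap)

lemma norm_transpose: "norm (transpose X) = norm (X :: real ^ _ ^ _)"
  by (simp add: norm_eq_sqrt_inner inner_transpose)

lemma inner_sandwich:
  fixes A :: "real ^ 'p ^ 'm" and X :: "real ^ 'q ^ 'p" and B :: "real ^ 'n ^ 'q"
  shows "inner (A ** X ** B) W = inner X (transpose A ** W ** transpose B)"
proof -
  have "inner (A ** X ** B) W = inner (transpose B ** transpose (A ** X)) (transpose W)"
    unfolding matrix_transpose_mul[symmetric] by (rule inner_transpose[symmetric])
  also have "\<dots> = inner (transpose (A ** X)) (transpose (W ** transpose B))"
    by (simp only: inner_matrix_mul_left matrix_transpose_mul)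
  also have "\<dots> = inner (A ** X) (W ** transpose B)"
    by (rule inner_transpose)
  finally show ?thesis by (simp add: inner_matrix_mul_left matrix_mul_assoc)
qed

lemma pinv_sandwich_in_range: "pinv A ** C ** pinv B \<in> sandwich_range A B"
proof -
  obtain V W where "pinv A = transpose A ** V" "pinv B = W ** transpose B"
    using pinv_eq_transpose_mul pinv_eq_mul_transpose by metis
  then have "pinv A ** C ** pinv B = transpose A ** (V ** C ** W) ** transpose B"
    by (simp add: matrix_mul_assoc)
  then show ?thesis by (auto simp: sandwich_range_def)
qed

lemma pinv_sandwich_solves:
  assumes "\<exists>Y. A ** Y ** B = C"
  shows "A ** (pinv A ** C ** pinv B) ** B = C"
proof -
  obtain Y where Y: "A ** Y ** B = C" using assms by blast
  have "A ** (pinv A ** C ** pinv B) ** B = (A ** pinv A ** A) ** Y ** (B ** pinv B ** B)"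
    unfolding Y[symmetric] by (simp only: matrix_mul_assoc)
  then show ?thesis
    using Y is_pinv_pinv[of A] is_pinv_pinv[of B] by (simp add: is_pinv_def)
qed

lemma least_norm_solution_pinv:
  assumes "\<exists>Y. A ** Y ** B = C"
  shows "least_norm_solution A B C Y \<longleftrightarrow> Y = pinv A ** C ** pinv B"
proof -
  let ?S = "pinv A ** C ** pinv B"
  have S: "A ** ?S ** B = C" by (rule pinv_sandwich_solves[OF assms])
  obtain W where W: "?S = transpose A ** W ** transpose B"
    using pinv_sandwich_in_range[of A C B] unfolding sandwich_range_def by blast
  have pyth: "(norm Z)\<^sup>2 = (norm ?S)\<^sup>2 + (norm (Z - ?S))\<^sup>2" if "A ** Z ** B = C" for Z
  proof -
    \<comment> \<open>The difference of two solutions lies in the kernel of X -> AXB, while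
      \<open>?S\<close> lies in the range of the adjoint map. Pythagoras then yields minimality and
      uniqueness together.\<close>
    have "inner (Z - ?S) ?S = 0"
      using that S W linear_diff[OF linear_sandwich[of A B], of Z ?S]
    by (metis diff_self inner_sandwich inner_zero_left)
    then show ?thesis
      using norm_add_Pythagorean[of ?S "Z - ?S"] by (simp add: orthogonal_def inner_commute)
  qed
  show ?thesis
  proof
    assume Y: "least_norm_solution A B C Y"
    then have Y': "A ** Y ** B = C" and "norm Y \<le> norm ?S"
      using S unfolding least_norm_solution_def by blast+
    then have "(norm Y)\<^sup>2 \<le> (norm ?S)\<^sup>2"
      by (intro power_mono norm_ge_zero)
    then have "(norm (Y - ?S))\<^sup>2 \<le> 0" using pyth[OF Y'] by linarith
    then have "norm (Y - ?S) = 0" by (simp only: power2_less_eq_zero_iff)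
    then show "Y = ?S" by (simp only: norm_eq_zero right_minus_eq)
  next
    assume "Y = ?S"
    moreover have "norm ?S \<le> norm Z" if "A ** Z ** B = C" for Z
      by (rule power2_le_imp_le) (use pyth[OF that] in simp_all)
    ultimately show "least_norm_solution A B C Y"
      using S unfolding least_norm_solution_def by blast
  qed
qed

subsection \<open>One row step\<close>

lemma matrix_mul_outer_mul:
  fixes A :: "real ^ 'p ^ 'm" and B :: "real ^ 'n ^ 'q"
  shows "A ** outer u v ** B = outer (A *v u) (v v* B)"
proof -
  have "A ** outer u v = outer (A *v u) v"
    by (simp add: vec_eq_iff outer_def matrix_matrix_mult_def matrix_vector_mult_def
        sum_distrib_left sum_distrib_right mult_ac)
  moreover have "outer w v ** B = outer w (v v* B)" for w :: "real ^ 'm"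
    by (simp add: vec_eq_iff outer_def matrix_matrix_mult_def vector_matrix_mult_def
        sum_distrib_left mult_ac)
  ultimately show ?thesis by simp
qed

lemma norm_outer: "norm (outer u v) = norm u * norm v"
proof -
  have "outer u v $ i = (u $ i) *\<^sub>R v" for i
    by (simp add: vec_eq_iff outer_def)
  moreover have "(norm u)\<^sup>2 = (\<Sum>i\<in>UNIV. (u $ i)\<^sup>2)"
    unfolding power2_norm_eq_inner by (simp add: inner_vec_def power2_eq_square)
  ultimately have "(norm (outer u v))\<^sup>2 = (norm u * norm v)\<^sup>2"
    unfolding power_mult_distrib norm_sq_rows[of "outer u v"]
    by (simp add: power_mult_distrib sum_distrib_right)
  then show ?thesis by simp
qed

lemma inner_outer_axis: "inner M (outer (axis i 1) v) = inner (M $ i) v"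
proof -
  have "outer (axis i 1) v $ j = (if j = i then v else 0)" for j
    by (simp add: vec_eq_iff outer_def axis_def)
  then have "inner M (outer (axis i 1) v) = (\<Sum>j\<in>UNIV. inner (M $ j) (if j = i then v else 0))"
    unfolding inner_vec_def[of M] by simp
  also have "\<dots> = (\<Sum>j\<in>UNIV. if j = i then inner (M $ j) v else 0)"
    by (rule sum.cong) auto
  finally show ?thesis by simp
qed

definition row_step ::
    "real ^ 'p ^ 'm \<Rightarrow> real ^ 'n ^ 'q \<Rightarrow> real \<Rightarrow> real ^ 'n ^ 'm \<Rightarrow> 'm \<Rightarrow> real ^ 'q ^ 'p" where
  "row_step A B \<alpha> R i = (\<alpha> / (norm (A $ i))\<^sup>2) *\<^sub>R outer (A $ i) (R $ i v* transpose B)"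

text \<open>Because A_i = A^T e_i, the step is the adjoint image of the matrix that keeps only row i
  of the residual. Both its membership in \<open>sandwich_range\<close> and its inner product with
  the error follow from this form.\<close>

lemma row_step_sandwich:
  "row_step A B \<alpha> R i
    = (\<alpha> / (norm (A $ i))\<^sup>2) *\<^sub>R (transpose A ** outer (axis i 1) (R $ i) ** transpose B)"
proof -
  have "transpose A *v axis i 1 = A $ i"
    by (metis matrix_vector_mult_basis column_transpose row_def vec_nth_inverse)
  then show ?thesis
    unfolding row_step_def matrix_mul_outer_mul by (simp only:)
qed

lemma row_step_in_range: "row_step A B \<alpha> R i \<in> sandwich_range A B"
  unfolding row_step_sandwich
  by (intro subspace_scale[OF subspace_sandwich_range]) (auto simp: sandwich_range_def)

text \<open>Identifies the prescribed residual update, written with AA^T and B^T B, with the change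
  that the step causes in AXB.\<close>

lemma sandwich_row_step:
  "A ** row_step A B \<alpha> R i ** B
    = (\<alpha> / (norm (A $ i))\<^sup>2) *\<^sub>R
        outer (column i (A ** transpose A)) (R $ i v* (transpose B ** B))"
proof -
  have "A *v (A $ i) = column i (A ** transpose A)"
    by (simp add: vec_eq_iff column_def matrix_matrix_mult_def matrix_vector_mult_def transpose_def)
  moreover have "(R $ i v* transpose B) v* B = R $ i v* (transpose B ** B)"
    by (rule vector_matrix_mul_assoc)
  ultimately show ?thesis
    unfolding row_step_def linear_cmul[OF linear_sandwich] matrix_mul_outer_mul by (simp only:)
qed

text \<open>Expand the square. By adjointness the cross term is exactly -2\<alpha> ||R_i||^2 /
  ||A_i||^2; the only estimate is ||R_i B^T|| \<le> ||B||_2 ||R_i|| in the quadratic term.\<close>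

lemma norm_row_step_error_le:
  fixes A :: "real ^ 'p ^ 'm" and B :: "real ^ 'n ^ 'q" and D :: "real ^ 'q ^ 'p"
  assumes "A $ i \<noteq> 0" and R: "R = - (A ** D ** B)"
  shows "(norm (D + row_step A B \<alpha> R i))\<^sup>2
    \<le> (norm D)\<^sup>2 - (2 * \<alpha> - \<alpha>\<^sup>2 * (spectral_norm B)\<^sup>2) * ((norm (R $ i))\<^sup>2 / (norm (A $ i))\<^sup>2)"
proof -
  let ?S = "row_step A B \<alpha> R i"
  have "inner D (transpose A ** outer (axis i 1) (R $ i) ** transpose B) = - (norm (R $ i))\<^sup>2"
    unfolding inner_sandwich[symmetric] inner_outer_axis
    using R by (simp add: power2_norm_eq_inner)
  then have in1: "inner D ?S = - \<alpha> * ((norm (R $ i))\<^sup>2 / (norm (A $ i))\<^sup>2)"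
    unfolding row_step_sandwich by simp
  have "norm (R $ i v* transpose B) \<le> spectral_norm B * norm (R $ i)"
    using norm_matrix_vector_le[of B "R $ i"] by simp
  then have "(norm (R $ i v* transpose B))\<^sup>2 \<le> (spectral_norm B * norm (R $ i))\<^sup>2"
    by (intro power_mono) auto
  then have "\<alpha>\<^sup>2 * (norm (R $ i v* transpose B))\<^sup>2 / (norm (A $ i))\<^sup>2
      \<le> \<alpha>\<^sup>2 * (spectral_norm B * norm (R $ i))\<^sup>2 / (norm (A $ i))\<^sup>2"
    by (intro divide_right_mono mult_left_mono) auto
  moreover have "(norm ?S)\<^sup>2 = \<alpha>\<^sup>2 * (norm (R $ i v* transpose B))\<^sup>2 / (norm (A $ i))\<^sup>2"
    unfolding row_step_def norm_scaleR norm_outer using assms(1)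
    by (simp add: power_mult_distrib power_divide) (simp add: field_simps power2_eq_square power4_eq_xxxx)
  ultimately have nS: "(norm ?S)\<^sup>2
      \<le> \<alpha>\<^sup>2 * (spectral_norm B)\<^sup>2 * ((norm (R $ i))\<^sup>2 / (norm (A $ i))\<^sup>2)"
    by (simp add: power_mult_distrib mult_ac)
  have "(norm (D + ?S))\<^sup>2 = (norm D)\<^sup>2 + 2 * inner D ?S + (norm ?S)\<^sup>2"
    unfolding power2_norm_eq_inner by (simp add: inner_add inner_commute)
  then show ?thesis
    using in1 nS by (simp add: algebra_simps)
qed

section \<open>Selection threshold and contraction factors\<close>

lemma gam_eq: "gam A R = (\<Sum>i\<in>- zero_rows R. (norm (A $ i))\<^sup>2)"
proof -
  have "(\<Sum>i\<in>UNIV. (norm (A $ i))\<^sup>2)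
      = (\<Sum>i\<in>UNIV - zero_rows R. (norm (A $ i))\<^sup>2) + (\<Sum>i\<in>zero_rows R. (norm (A $ i))\<^sup>2)"
    by (rule sum.subset_diff) auto
  then show ?thesis unfolding gam_def norm_sq_rows[of A] by (simp add: Compl_eq_Diff_UNIV)
qed

lemma gam_pos:
  assumes "\<forall>i. A $ i \<noteq> 0" "R \<noteq> 0"
  shows "0 < gam A R"
proof -
  obtain i where "R $ i \<noteq> 0" using assms(2) by (metis vec_eq_iff zero_index)
  then have "i \<in> - zero_rows R" by (simp add: zero_rows_def)
  then show ?thesis unfolding gam_eq using assms(1) by (intro sum_pos2[of _ i]) auto
qed

lemma gam_le: "gam A R \<le> (norm A)\<^sup>2"
  unfolding gam_def by (simp add: sum_nonneg)

text \<open>The maximal ratio dominates the average of the ratios with weights ||A_j||^2 over the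
  rows with nonzero residual, and that average is ||R||_F^2 / \<open>gam A R\<close>. Inserting this
  into the \<theta>-part of \<open>xi\<close> gives the bound.\<close>

lemma index_set_lower_bound:
  assumes rows: "\<forall>i. A $ i \<noteq> 0" and R: "R \<noteq> 0" and \<theta>: "0 < \<theta>" and i: "i \<in> index_set A \<theta> R"
  shows "(\<theta> / gam A R + (1 - \<theta>) / (norm A)\<^sup>2) * (norm R)\<^sup>2
    \<le> (norm (R $ i))\<^sup>2 / (norm (A $ i))\<^sup>2"
proof -
  define m where "m = Max (range (\<lambda>i. (norm (R $ i))\<^sup>2 / (norm (A $ i))\<^sup>2))"
  have "(norm (R $ j))\<^sup>2 / (norm (A $ j))\<^sup>2 \<le> m" for j
    unfolding m_def by (rule Max_ge) auto
  then have rj: "(norm (R $ j))\<^sup>2 \<le> m * (norm (A $ j))\<^sup>2" for j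
    using rows by (simp add: pos_divide_le_eq)
  \<comment> \<open>Zero residual rows drop out of this sum, so only the remaining rows of A have to
    be counted: hence \<open>gam\<close> instead of ||A||_F^2.\<close>
  have "(norm R)\<^sup>2 = (\<Sum>j\<in>- zero_rows R. (norm (R $ j))\<^sup>2)"
    unfolding norm_sq_rows[of R] by (rule sum.mono_neutral_right) (auto simp: zero_rows_def)
  also have "\<dots> \<le> m * gam A R"
    unfolding gam_eq sum_distrib_left by (intro sum_mono rj)
  finally have m: "(norm R)\<^sup>2 / gam A R \<le> m"
    using gam_pos[OF rows R] by (simp add: pos_divide_le_eq)
  have "xi A \<theta> R * (norm R)\<^sup>2 = \<theta> * m + (1 - \<theta>) / (norm A)\<^sup>2 * (norm R)\<^sup>2"
    unfolding xi_def m_def[symmetric] using R by (simp add: distrib_right)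
  moreover have "xi A \<theta> R * (norm R)\<^sup>2 \<le> (norm (R $ i))\<^sup>2 / (norm (A $ i))\<^sup>2"
    using i rows by (simp add: index_set_def pos_le_divide_eq mult_ac)
  moreover have "\<theta> * ((norm R)\<^sup>2 / gam A R) \<le> \<theta> * m"
    using m \<theta> by (intro mult_left_mono) auto
  ultimately show ?thesis by (simp add: algebra_simps)
qed

lemma step_gain_pos:
  assumes "B \<noteq> 0" "0 < \<alpha>" "\<alpha> < 2 / (spectral_norm B)\<^sup>2"
  shows "0 < 2 * \<alpha> - \<alpha>\<^sup>2 * (spectral_norm B)\<^sup>2"
proof -
  have "\<alpha> * (spectral_norm B)\<^sup>2 < 2"
    using assms spectral_norm_pos[OF assms(1)] by (simp add: pos_less_divide_eq)
  then have "\<alpha> * (\<alpha> * (spectral_norm B)\<^sup>2) < \<alpha> * 2"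
    using assms(2) by (rule mult_strict_left_mono)
  then show ?thesis by (simp add: power2_eq_square mult_ac)
qed

lemma kappa_F2_kron_sq:
  "(kappa_F2 (kron (transpose B) A))\<^sup>2
    = (norm A)\<^sup>2 * (norm B)\<^sup>2 * (spectral_norm (pinv (kron (transpose B) A)))\<^sup>2"
  by (simp add: kappa_F2_def norm_kron norm_transpose power_mult_distrib mult_ac)

text \<open>The factor ||A||_F^2 ||B||_F^2 cancels between \<open>phi\<close> and the squared
  condition number. What remains is the constant of \<open>index_set_lower_bound\<close>.\<close>

lemma rho_eq:
  assumes "A \<noteq> 0" "B \<noteq> 0"
  shows "rho A B \<alpha> \<theta> R = 1 - (2 * \<alpha> - \<alpha>\<^sup>2 * (spectral_norm B)\<^sup>2) *
    (\<theta> / gam A R + (1 - \<theta>) / (norm A)\<^sup>2) / (spectral_norm (pinv (kron (transpose B) A)))\<^sup>2"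
proof -
  have "phi A B \<theta> R = (norm A)\<^sup>2 * (norm B)\<^sup>2 * (\<theta> / gam A R + (1 - \<theta>) / (norm A)\<^sup>2)"
    unfolding phi_def using assms by (simp add: norm_kron norm_transpose power_mult_distrib distrib_left)
  then show ?thesis
    unfolding rho_def kappa_F2_kron_sq using assms by simp
qed

text \<open>\<open>rho0\<close> is the value of the factor for \<open>gam\<close> = ||A||_F^2, and
  \<open>gam\<close> never exceeds that. The comparison serves both the first iteration and the
  uniform rate behind convergence.\<close>

lemma rho_le_rho0:
  assumes rows: "\<forall>i. A $ i \<noteq> 0" and "B \<noteq> 0" and R: "R \<noteq> 0" and \<theta>: "0 < \<theta>"
    and alpha: "0 < \<alpha>" "\<alpha> < 2 / (spectral_norm B)\<^sup>2"
  shows "rho A B \<alpha> \<theta> R \<le> rho0 A B \<alpha>"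
proof -
  have A: "A \<noteq> 0" using rows by auto
  have "\<theta> / (norm A)\<^sup>2 \<le> \<theta> / gam A R"
    using gam_pos[OF rows R] gam_le[of A R] \<theta> by (intro divide_left_mono) (auto simp: A)
  then have "1 / (norm A)\<^sup>2 \<le> \<theta> / gam A R + (1 - \<theta>) / (norm A)\<^sup>2"
    by (simp add: diff_divide_distrib)
  moreover have "rho0 A B \<alpha> = 1 - (2 * \<alpha> - \<alpha>\<^sup>2 * (spectral_norm B)\<^sup>2) *
      (1 / (norm A)\<^sup>2) / (spectral_norm (pinv (kron (transpose B) A)))\<^sup>2"
    unfolding rho0_def kappa_F2_kron_sq using A \<open>B \<noteq> 0\<close> by simp
  ultimately show ?thesis
    unfolding rho_eq[OF A \<open>B \<noteq> 0\<close>]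
    using step_gain_pos[OF \<open>B \<noteq> 0\<close> alpha]
    by (simp only:) (intro diff_left_mono divide_right_mono mult_left_mono, auto)
qed

lemma rho0_less_1:
  assumes "A \<noteq> 0" "B \<noteq> 0" "0 < \<alpha>" "\<alpha> < 2 / (spectral_norm B)\<^sup>2"
  shows "rho0 A B \<alpha> < 1"
proof -
  \<comment> \<open>Strictness depends on a positive ||(B^T \<otimes> A)^+||_2: were it 0, the
    quotient in \<open>rho0\<close> would default to 0 and \<open>rho0\<close> would be 1.\<close>
  have "norm (kron (transpose B) A) \<noteq> 0"
    using assms by (simp add: norm_kron norm_transpose)
  then have "pinv (kron (transpose B) A) \<noteq> 0"
    by (intro pinv_nonzero) auto
  then have "0 < spectral_norm (pinv (kron (transpose B) A))"
    by (rule spectral_norm_pos)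
  then show ?thesis
    unfolding rho0_def kappa_F2_kron_sq
    using step_gain_pos[of B \<alpha>] assms by simp
qed

lemma row_step_contraction:
  assumes rows: "\<forall>i. A $ i \<noteq> 0" and "B \<noteq> 0" and \<theta>: "0 < \<theta>" "\<theta> < 1"
    and alpha: "0 < \<alpha>" "\<alpha> < 2 / (spectral_norm B)\<^sup>2"
    and D: "D \<in> sandwich_range A B" and R: "R = - (A ** D ** B)" "R \<noteq> 0"
    and i: "i \<in> index_set A \<theta> R"
  shows "(norm (D + row_step A B \<alpha> R i))\<^sup>2 \<le> rho A B \<alpha> \<theta> R * (norm D)\<^sup>2"
proof -
  define s where "s = spectral_norm (pinv (kron (transpose B) A))"
  define c where "c = 2 * \<alpha> - \<alpha>\<^sup>2 * (spectral_norm B)\<^sup>2"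
  define t where "t = \<theta> / gam A R + (1 - \<theta>) / (norm A)\<^sup>2"
  have A: "A \<noteq> 0" using rows by auto
  have c: "0 < c" unfolding c_def by (rule step_gain_pos[OF \<open>B \<noteq> 0\<close> alpha])
  have t: "0 \<le> t" unfolding t_def using gam_pos[OF rows R(2)] \<theta> by simp
  have "norm D \<le> s * norm R"
    using norm_le_sandwich[OF D] by (simp add: s_def R(1))
  then have "(norm D)\<^sup>2 \<le> s\<^sup>2 * (norm R)\<^sup>2"
    unfolding power_mult_distrib[symmetric] by (intro power_mono) auto
  \<comment> \<open>For \<open>s = 0\<close> the quotient has the default value 0, and the
    inequality is trivial.\<close>
  then have "(norm D)\<^sup>2 / s\<^sup>2 \<le> (norm R)\<^sup>2"
    by (cases "s = 0") (simp_all add: pos_divide_le_eq mult_ac)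
  then have "t * ((norm D)\<^sup>2 / s\<^sup>2) \<le> t * (norm R)\<^sup>2"
    using t by (rule mult_left_mono)
  also have "\<dots> \<le> (norm (R $ i))\<^sup>2 / (norm (A $ i))\<^sup>2"
    unfolding t_def by (rule index_set_lower_bound[OF rows R(2) \<theta>(1) i])
  finally have "c * (t * ((norm D)\<^sup>2 / s\<^sup>2)) \<le> c * ((norm (R $ i))\<^sup>2 / (norm (A $ i))\<^sup>2)"
    using c by (intro mult_left_mono) auto
  moreover have "(norm (D + row_step A B \<alpha> R i))\<^sup>2
      \<le> (norm D)\<^sup>2 - c * ((norm (R $ i))\<^sup>2 / (norm (A $ i))\<^sup>2)"
    unfolding c_def by (rule norm_row_step_error_le) (use rows R in auto)
  moreover have "rho A B \<alpha> \<theta> R * (norm D)\<^sup>2 = (norm D)\<^sup>2 - c * (t * ((norm D)\<^sup>2 / s\<^sup>2))"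
    unfolding rho_eq[OF A \<open>B \<noteq> 0\<close>] c_def[symmetric] t_def[symmetric] s_def[symmetric]
    by (simp add: left_diff_distrib)
  ultimately show ?thesis by linarith
qed

subsection \<open>The random iteration\<close>

lemma space_past [simp]: "space (past M I k) = space M"
  by (simp add: past_def space_measure_of_conv)

lemma sets_past: "sets (past M I k) = sigma_sets (space M) {I s -` {i} \<inter> space M | s i. s < k}"
  unfolding past_def by (rule sets_measure_of) auto

lemma subalgebra_past:
  assumes "\<And>k. I k \<in> measurable M (count_space UNIV)"
  shows "subalgebra M (past M I k)"
proof -
  have "{I s -` {i} \<inter> space M | s i. s < k} \<subseteq> sets M"
    using measurable_sets[OF assms] by fastforce
  then show ?thesis
    unfolding subalgebra_def sets_past by (simp add: sets.sigma_sets_subset)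
qed

lemma sets_past_Suc: "sets (past M I k) \<subseteq> sets (past M I (Suc k))"
  unfolding sets_past by (rule sigma_sets_mono') (auto simp: less_Suc_eq)

lemma simple_function_past_Suc:
  "simple_function (past M I k) f \<Longrightarrow> simple_function (past M I (Suc k)) f"
  using sets_past_Suc[of M I k] by (auto simp: simple_function_def)

lemma simple_function_past_index:
  fixes I :: "nat \<Rightarrow> 'a \<Rightarrow> 'm::finite"
  shows "simple_function (past M I (Suc k)) (I k)"
  unfolding simple_function_def sets_past by (auto intro!: sigma_sets.Basic)

text \<open>The old state and the drawn row determine the new state. Simple functions stay simple
  under any map, so \<open>h\<close> is arbitrary and the update formula raises no measurability
  question.\<close>

lemma simple_function_fun_past_Suc:
  fixes I :: "nat \<Rightarrow> 'a \<Rightarrow> 'm::finite"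
  assumes "simple_function (past M I k) f"
    and g: "\<And>\<omega>. \<omega> \<in> space M \<Longrightarrow> g \<omega> = h (f \<omega>) (I k \<omega>)"
  shows "simple_function (past M I (Suc k)) g"
proof -
  have "simple_function (past M I (Suc k)) (\<lambda>\<omega>. h (f \<omega>) (I k \<omega>))"
    by (rule simple_function_compose2[OF simple_function_past_Suc[OF assms(1)]
          simple_function_past_index])
  then show ?thesis
    using g by (subst simple_function_cong) auto
qed

text \<open>The target enters as a solution in the row space, the form in which the error analysis
  uses it; the expression by Moore-Penrose inverses is substituted only in the final
  theorem.\<close>

locale rgrbk = prob_space M
  for M :: "'a measure" +
  fixes A :: "real ^ 'p ^ 'm" and B :: "real ^ 'n ^ 'q" and C :: "real ^ 'n ^ 'm"
    and X0 Xs :: "real ^ 'q ^ 'p" and \<alpha> \<theta> :: real and I :: "nat \<Rightarrow> 'a \<Rightarrow> 'm"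
    and X :: "nat \<Rightarrow> 'a \<Rightarrow> real ^ 'q ^ 'p" and R :: "nat \<Rightarrow> 'a \<Rightarrow> real ^ 'n ^ 'm"
  assumes rows: "\<forall>i. A $ i \<noteq> 0" and B: "B \<noteq> 0"
    and theta: "0 < \<theta>" "\<theta> < 1"
    and alpha: "0 < \<alpha>" "\<alpha> < 2 / (spectral_norm B)\<^sup>2"
    and X0: "X0 \<in> sandwich_range A B"
    and Xs: "Xs \<in> sandwich_range A B" "A ** Xs ** B = C"
    and process: "me_rgrbk A B C \<alpha> \<theta> X0 M I X R"
begin

abbreviation err :: "nat \<Rightarrow> 'a \<Rightarrow> real" where
  "err k \<omega> \<equiv> (norm (X k \<omega> - Xs))\<^sup>2"

lemma index_measurable: "I k \<in> measurable M (count_space UNIV)"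
  using process by (simp add: me_rgrbk_def)

lemma X_0: "\<omega> \<in> space M \<Longrightarrow> X 0 \<omega> = X0"
  and R_0: "\<omega> \<in> space M \<Longrightarrow> R 0 \<omega> = C - A ** X0 ** B"
  using process by (auto simp: me_rgrbk_def)

lemma X_Suc: "\<omega> \<in> space M \<Longrightarrow> X (Suc k) \<omega> = X k \<omega> + row_step A B \<alpha> (R k \<omega>) (I k \<omega>)"
  and R_Suc: "\<omega> \<in> space M \<Longrightarrow>
    R (Suc k) \<omega> = R k \<omega> - A ** row_step A B \<alpha> (R k \<omega>) (I k \<omega>) ** B"
  unfolding sandwich_row_step using process
  by (simp_all add: me_rgrbk_def Let_def row_step_def)

lemma R_eq:
  assumes "\<omega> \<in> space M"
  shows "R k \<omega> = - (A ** (X k \<omega> - Xs) ** B)"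
proof (induction k)
  case 0
  show ?case using assms by (simp add: X_0 R_0 linear_diff[OF linear_sandwich] Xs(2))
next
  case (Suc k)
  then show ?case
    using assms by (simp add: X_Suc R_Suc linear_diff[OF linear_sandwich]
        linear_add[OF linear_sandwich])
qed

text \<open>The range is a subspace containing the start, the target and every row step. The
  condition on the initial matrix enters here.\<close>

lemma error_in_range:
  assumes "\<omega> \<in> space M"
  shows "X k \<omega> - Xs \<in> sandwich_range A B"
proof (induction k)
  case 0
  show ?case
    using assms X0 Xs(1) by (simp add: X_0 subspace_diff[OF subspace_sandwich_range])
next
  case (Suc k)
  from subspace_add[OF subspace_sandwich_range this row_step_in_range] show ?case
    using assms by (simp add: X_Suc add_diff_eq diff_add_eq)
qed

text \<open>The map E -> AEB is injective on the row space, by the bound through the Moore-Penrose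
  inverse. Stopping is therefore the same as having reached \<open>Xs\<close>.\<close>

lemma R_zero_iff: "\<omega> \<in> space M \<Longrightarrow> R k \<omega> = 0 \<longleftrightarrow> X k \<omega> = Xs"
  using norm_le_sandwich[OF error_in_range, of \<omega> k] R_eq[of \<omega> k]
    linear_0[OF linear_sandwich[of A B]] by auto

lemma stopped:
  assumes "\<omega> \<in> space M" "R k \<omega> = 0"
  shows "X (Suc k) \<omega> = Xs" "R (Suc k) \<omega> = 0"
proof -
  have "outer u (0 :: real ^ 'q) = 0" for u :: "real ^ 'p"
    by (simp add: outer_def vec_eq_iff)
  then have "row_step A B \<alpha> (R k \<omega>) (I k \<omega>) = 0"
    using assms by (simp add: row_step_def)
  then show "X (Suc k) \<omega> = Xs"
    using assms R_zero_iff[OF assms(1), of k] by (simp add: X_Suc)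
  then show "R (Suc k) \<omega> = 0"
    by (simp only: R_zero_iff[OF assms(1)])
qed

lemma simple_X_R: "simple_function (past M I k) (\<lambda>\<omega>. (X k \<omega>, R k \<omega>))"
proof (induction k)
  case 0
  have "simple_function (past M I 0) (\<lambda>\<omega>. (X0, C - A ** X0 ** B))"
    by (rule simple_function_const)
  then show ?case by (subst simple_function_cong[of _ _ "\<lambda>\<omega>. (X0, C - A ** X0 ** B)"]) (auto simp: X_0 R_0)
next
  case (Suc k)
  then show ?case
    by (rule simple_function_fun_past_Suc[where h = "\<lambda>p i.
          (fst p + row_step A B \<alpha> (snd p) i, snd p - A ** row_step A B \<alpha> (snd p) i ** B)"])
      (simp add: X_Suc R_Suc)
qed

lemma simple_fun_X_R: "simple_function (past M I k) (\<lambda>\<omega>. h (X k \<omega>) (R k \<omega>))"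
  using simple_function_compose1[OF simple_X_R, of k "\<lambda>p. h (fst p) (snd p)"] by simp

lemma integrable_simple_past:
  fixes f :: "'a \<Rightarrow> real"
  assumes "simple_function (past M I k) f"
  shows "integrable M f"
proof -
  have f: "f \<in> borel_measurable M"
    by (rule measurable_from_subalg[OF subalgebra_past[OF index_measurable]
          borel_measurable_simple_function[OF assms]])
  have "finite ((\<lambda>\<omega>. norm (f \<omega>)) ` space M)"
    using simple_functionD(1)[OF simple_function_compose1[OF assms, of norm]] by simp
  then have "AE \<omega> in M. norm (f \<omega>) \<le> Max ((\<lambda>\<omega>. norm (f \<omega>)) ` space M)"
    by (simp add: AE_I2)
  then show ?thesis
    using f by (rule integrable_const_bound)
qed

lemma sigma_finite_past: "sigma_finite_subalgebra M (past M I k)"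
  using finite_measure_axioms subalgebra_past[OF index_measurable]
  by (intro finite_measure_subalgebra_is_sigma_finite finite_measure_subalgebra.intro
      finite_measure_subalgebra_axioms.intro)

text \<open>Turns the conditional law into an almost sure statement. For fixed i, the event
  \<open>Q\<close> that i is inadmissible belongs to the past, so the probability of drawing i on
  \<open>Q\<close> is the integral over \<open>Q\<close> of the conditional probability, which
  vanishes there. Finitely many i leave a single null set.\<close>

lemma selected_in_index_set:
  "AE \<omega> in M. R k \<omega> \<noteq> 0 \<longrightarrow> I k \<omega> \<in> index_set A \<theta> (R k \<omega>)"
proof -
  interpret sigma_finite_subalgebra M "past M I k" by (rule sigma_finite_past)
  have "AE \<omega> in M. R k \<omega> \<noteq> 0 \<and> i \<notin> index_set A \<theta> (R k \<omega>) \<longrightarrow> I k \<omega> \<noteq> i" for i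
  proof -
    define Q where "Q = {\<omega> \<in> space M. R k \<omega> \<noteq> 0 \<and> i \<notin> index_set A \<theta> (R k \<omega>)}"
    define J where "J = {\<omega> \<in> space M. I k \<omega> = i}"
    have Q: "Q \<in> sets (past M I k)"
      using simple_functionD(2)[OF simple_fun_X_R[of k
          "\<lambda>x r. r \<noteq> 0 \<and> i \<notin> index_set A \<theta> r"], of "{True}"]
      by (simp add: Q_def vimage_def Int_def conj_commute)
    then have QM: "Q \<in> sets M"
      using subalg by (auto simp: subalgebra_def)
    have J: "J \<in> sets M"
      using measurable_sets[OF index_measurable, of "{i}" k]
      by (simp add: J_def vimage_def Int_def conj_commute)
    have "AE \<omega> in M. R k \<omega> \<noteq> 0 \<longrightarrow>
        real_cond_exp M (past M I k) (indicator J) \<omega> = select_prob A \<theta> (R k \<omega>) i"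
      using process by (simp add: me_rgrbk_def J_def)
    \<comment> \<open>On \<open>Q\<close> row i of the truncated residual is zero, hence so is
      \<open>select_prob\<close>; off \<open>Q\<close> the indicator vanishes.\<close>
    then have z: "AE \<omega> in M. indicator Q \<omega> *\<^sub>R real_cond_exp M (past M I k) (indicator J) \<omega> = 0"
      by eventually_elim (auto simp: indicator_def Q_def select_prob_def trunc_residual_def split: if_splits)
    have "measure M (Q \<inter> J) = (\<integral>\<omega>\<in>Q. indicator J \<omega> \<partial>M)"
      using QM J by (simp add: set_lebesgue_integral_def flip: indicator_inter_arith)
    also have "\<dots> = (\<integral>\<omega>\<in>Q. real_cond_exp M (past M I k) (indicator J) \<omega> \<partial>M)"
      using Q J by (intro real_cond_exp_intA integrable_real_indicator) (simp_all add: less_top[symmetric])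
    also have "\<dots> = 0"
      unfolding set_lebesgue_integral_def by (rule integral_eq_zero_AE[OF z])
    finally have "Q \<inter> J \<in> null_sets M"
      using QM J by (auto simp: emeasure_eq_measure)
    from AE_not_in[OF this] AE_space show ?thesis
      by eventually_elim (auto simp: Q_def J_def)
  qed
  then have "AE \<omega> in M. \<forall>i. R k \<omega> \<noteq> 0 \<and> i \<notin> index_set A \<theta> (R k \<omega>) \<longrightarrow> I k \<omega> \<noteq> i"
    by (simp add: AE_all_countable)
  then show ?thesis by eventually_elim blast
qed

lemma contraction:
  "AE \<omega> in M. \<forall>k. R k \<omega> \<noteq> 0 \<longrightarrow> err (Suc k) \<omega> \<le> rho A B \<alpha> \<theta> (R k \<omega>) * err k \<omega>"
  unfolding AE_all_countable
proof
  fix k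
  from selected_in_index_set[of k] AE_space
  show "AE \<omega> in M. R k \<omega> \<noteq> 0 \<longrightarrow> err (Suc k) \<omega> \<le> rho A B \<alpha> \<theta> (R k \<omega>) * err k \<omega>"
  proof eventually_elim
    case (elim \<omega>)
    show ?case
    proof
      assume R: "R k \<omega> \<noteq> 0"
      have "X (Suc k) \<omega> - Xs = X k \<omega> - Xs + row_step A B \<alpha> (R k \<omega>) (I k \<omega>)"
        unfolding X_Suc[OF elim(2)] by (simp only: diff_add_eq)
      moreover have "I k \<omega> \<in> index_set A \<theta> (R k \<omega>)"
        using elim(1) R by blast
      ultimately show "err (Suc k) \<omega> \<le> rho A B \<alpha> \<theta> (R k \<omega>) * err k \<omega>"
        using row_step_contraction[OF rows B theta alpha error_in_range[OF elim(2)]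
            R_eq[OF elim(2)] R] by (simp only:)
    qed
  qed
qed

text \<open>The maximum with 0 makes the factor nonnegative by construction, as iterating the bound
  into powers requires. A stopped realization satisfies it with error 0.\<close>

lemma contraction_rho0: "AE \<omega> in M. \<forall>k. err (Suc k) \<omega> \<le> max 0 (rho0 A B \<alpha>) * err k \<omega>"
  using contraction AE_space
proof eventually_elim
  case (elim \<omega>)
  show ?case
  proof
    fix k
    show "err (Suc k) \<omega> \<le> max 0 (rho0 A B \<alpha>) * err k \<omega>"
    proof (cases "R k \<omega> = 0")
      case True
      then show ?thesis using elim(2) stopped(1)[of \<omega> k] by simp
    next
      case False
      then have "err (Suc k) \<omega> \<le> rho A B \<alpha> \<theta> (R k \<omega>) * err k \<omega>"
        using elim by blast
      also have "\<dots> \<le> max 0 (rho0 A B \<alpha>) * err k \<omega>"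
        using rho_le_rho0[OF rows B False theta(1) alpha] by (intro mult_right_mono) auto
      finally show ?thesis .
    qed
  qed
qed

section \<open>Expected and conditional errors\<close>

lemma integrable_err: "integrable M (err k)"
  using integrable_simple_past[OF simple_fun_X_R] .

lemma expected_err_tendsto_0: "(\<lambda>k. \<integral>\<omega>. err k \<omega> \<partial>M) \<longlonglongrightarrow> 0"
proof -
  define r where "r = max 0 (rho0 A B \<alpha>)"
  have "A \<noteq> 0" using rows by auto
  then have r: "0 \<le> r" "r < 1"
    using rho0_less_1[OF _ B alpha] by (auto simp: r_def)
  have "(\<integral>\<omega>. err k \<omega> \<partial>M) \<le> r ^ k * (norm (X0 - Xs))\<^sup>2" for k
  proof -
    have "AE \<omega> in M. err k \<omega> \<le> r ^ k * (norm (X0 - Xs))\<^sup>2"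
      using contraction_rho0 AE_space
    proof eventually_elim
      case (elim \<omega>)
      show ?case
      proof (induction k)
        case 0
        show ?case using elim by (simp add: X_0)
      next
        case (Suc k)
        have "err (Suc k) \<omega> \<le> r * err k \<omega>" using elim by (simp add: r_def)
        also have "\<dots> \<le> r * (r ^ k * (norm (X0 - Xs))\<^sup>2)"
          using Suc r(1) by (rule mult_left_mono)
        finally show ?case by (simp add: mult_ac)
      qed
    qed
    then have "(\<integral>\<omega>. err k \<omega> \<partial>M) \<le> (\<integral>\<omega>. r ^ k * (norm (X0 - Xs))\<^sup>2 \<partial>M)"
      by (intro integral_mono_AE integrable_err) auto
    then show ?thesis by (simp add: prob_space)
  qed
  then have upper: "\<forall>\<^sub>F k in sequentially. (\<integral>\<omega>. err k \<omega> \<partial>M) \<le> r ^ k * (norm (X0 - Xs))\<^sup>2"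
    by (rule always_eventually[OF allI])
  have lower: "\<forall>\<^sub>F k in sequentially. 0 \<le> (\<integral>\<omega>. err k \<omega> \<partial>M)"
    by (rule always_eventually) (simp add: integral_nonneg_AE)
  have "(\<lambda>k. r ^ k) \<longlonglongrightarrow> 0"
    using r by (rule LIMSEQ_realpow_zero)
  then have "(\<lambda>k. r ^ k * (norm (X0 - Xs))\<^sup>2) \<longlonglongrightarrow> 0"
    by (rule tendsto_mult_left_zero)
  then show ?thesis
    by (rule tendsto_sandwich[OF lower upper tendsto_const])
qed

lemma expected_err_1: "(\<integral>\<omega>. err 1 \<omega> \<partial>M) \<le> rho0 A B \<alpha> * (norm (X0 - Xs))\<^sup>2"
proof -
  have "AE \<omega> in M. err 1 \<omega> \<le> rho0 A B \<alpha> * (norm (X0 - Xs))\<^sup>2"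
    using contraction AE_space
  proof eventually_elim
    case (elim \<omega>)
    show ?case
    proof (cases "R 0 \<omega> = 0")
      case True
      then show ?thesis using elim stopped[of \<omega> 0] R_zero_iff[of \<omega> 0] by (simp add: X_0)
    next
      case False
      then have "err 1 \<omega> \<le> rho A B \<alpha> \<theta> (R 0 \<omega>) * err 0 \<omega>"
        using elim by simp
      also have "\<dots> \<le> rho0 A B \<alpha> * err 0 \<omega>"
        using rho_le_rho0[OF rows B False theta(1) alpha] by (intro mult_right_mono) auto
      finally show ?thesis using elim by (simp add: X_0)
    qed
  qed
  then have "(\<integral>\<omega>. err 1 \<omega> \<partial>M) \<le> (\<integral>\<omega>. rho0 A B \<alpha> * (norm (X0 - Xs))\<^sup>2 \<partial>M)"
    by (intro integral_mono_AE integrable_err) auto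
  then show ?thesis by (simp add: prob_space)
qed

lemma cond_exp_err:
  "AE \<omega> in M. R k \<omega> \<noteq> 0 \<longrightarrow>
     real_cond_exp M (past M I k) (err (Suc k)) \<omega> \<le> rho A B \<alpha> \<theta> (R k \<omega>) * err k \<omega>"
proof -
  interpret sigma_finite_subalgebra M "past M I k" by (rule sigma_finite_past)
  \<comment> \<open>Setting \<open>g\<close> to 0 on stopped realizations makes it an almost sure
    upper bound for the next error without a case distinction. It is determined by the past, so it
    is its own conditional expectation.\<close>
  define g where "g = (\<lambda>\<omega>. if R k \<omega> = 0 then 0 else rho A B \<alpha> \<theta> (R k \<omega>) * err k \<omega>)"
  have sg: "simple_function (past M I k) g"
    unfolding g_def
    by (rule simple_fun_X_R[of k "\<lambda>x r. if r = 0 then 0 else rho A B \<alpha> \<theta> r * (norm (x - Xs))\<^sup>2"])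
  have g: "integrable M g" by (rule integrable_simple_past[OF sg])
  have "AE \<omega> in M. err (Suc k) \<omega> \<le> g \<omega>"
    using contraction AE_space by eventually_elim (auto simp: g_def stopped)
  then have "AE \<omega> in M. real_cond_exp M (past M I k) (err (Suc k)) \<omega>
      \<le> real_cond_exp M (past M I k) g \<omega>"
    by (rule real_cond_exp_mono[OF _ integrable_err g])
  moreover have "AE \<omega> in M. real_cond_exp M (past M I k) g \<omega> = g \<omega>"
    by (rule real_cond_exp_F_meas[OF g borel_measurable_simple_function[OF sg]])
  ultimately show ?thesis
    by eventually_elim (auto simp: g_def)
qed

lemma simple_rho_prod: "simple_function (past M I k) (\<lambda>\<omega>. rho_prod A B \<alpha> \<theta> (\<lambda>l. R l \<omega>) k)"
proof (induction k)
  case 0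
  show ?case by (simp add: rho_prod_def)
next
  case (Suc k)
  from simple_function_mult[OF simple_function_past_Suc[OF this]
      simple_fun_X_R[of "Suc k" "\<lambda>x. rho A B \<alpha> \<theta>"]]
  show ?case by (simp add: rho_prod_def)
qed

text \<open>Induction along one realization that is still running. The indicator may discard all
  others, since their next error is exactly 0; this also removes any product containing a
  meaningless factor at a zero residual.\<close>

lemma err_le_rho_prod:
  "AE \<omega> in M. \<forall>k. err (Suc k) \<omega>
     \<le> rho_prod A B \<alpha> \<theta> (\<lambda>l. R l \<omega>) k * indicator {\<omega>. R k \<omega> \<noteq> 0} \<omega> * (norm (X0 - Xs))\<^sup>2"
  using contraction AE_space
proof eventually_elim
  case (elim \<omega>)
  have "R k \<omega> \<noteq> 0 \<longrightarrow> err (Suc k) \<omega> \<le> rho_prod A B \<alpha> \<theta> (\<lambda>l. R l \<omega>) k * (norm (X0 - Xs))\<^sup>2" for k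
  proof (induction k)
    case 0
    show ?case
    proof
      assume R: "R 0 \<omega> \<noteq> 0"
      then have "err (Suc 0) \<omega> \<le> rho A B \<alpha> \<theta> (R 0 \<omega>) * err 0 \<omega>"
        using elim by blast
      also have "\<dots> \<le> rho0 A B \<alpha> * err 0 \<omega>"
        using rho_le_rho0[OF rows B R theta(1) alpha] by (intro mult_right_mono) auto
      finally show "err (Suc 0) \<omega> \<le> rho_prod A B \<alpha> \<theta> (\<lambda>l. R l \<omega>) 0 * (norm (X0 - Xs))\<^sup>2"
        using elim by (simp add: rho_prod_def X_0)
    qed
  next
    case (Suc k)
    show ?case
    proof
      assume R: "R (Suc k) \<omega> \<noteq> 0"
      let ?r = "rho A B \<alpha> \<theta> (R (Suc k) \<omega>)"
      have c: "err (Suc (Suc k)) \<omega> \<le> ?r * err (Suc k) \<omega>"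
        using elim R by blast
      \<comment> \<open>The sign of the new factor is read off the contraction: its product with a
        positive error bounds a nonnegative quantity.\<close>
      have "0 < err (Suc k) \<omega>"
        using R R_zero_iff[of \<omega> "Suc k"] elim by simp
      moreover have "0 \<le> ?r * err (Suc k) \<omega>"
        using c by (rule order_trans[rotated]) simp
      ultimately have r: "0 \<le> ?r"
        by (simp add: zero_le_mult_iff)
      \<comment> \<open>A zero residual persists, so a realization running at \<open>Suc k\<close>
        was running at \<open>k\<close>, and the induction hypothesis applies.\<close>
      have "R k \<omega> \<noteq> 0" using R stopped elim by blast
      with Suc have "?r * err (Suc k) \<omega>
          \<le> ?r * (rho_prod A B \<alpha> \<theta> (\<lambda>l. R l \<omega>) k * (norm (X0 - Xs))\<^sup>2)"
        using r by (intro mult_left_mono) auto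
      with c show "err (Suc (Suc k)) \<omega>
          \<le> rho_prod A B \<alpha> \<theta> (\<lambda>l. R l \<omega>) (Suc k) * (norm (X0 - Xs))\<^sup>2"
        by (simp add: rho_prod_def mult_ac)
    qed
  qed
  then show ?case
    using elim stopped(1)[of \<omega>] by (auto simp: indicator_def)
qed

lemma expected_err_le_rho_prod:
  "(\<integral>\<omega>. err (Suc k) \<omega> \<partial>M)
     \<le> (\<integral>\<omega>. rho_prod A B \<alpha> \<theta> (\<lambda>l. R l \<omega>) k * indicator {\<omega>. R k \<omega> \<noteq> 0} \<omega> \<partial>M)
         * (norm (X0 - Xs))\<^sup>2"
proof -
  have "simple_function (past M I k) (\<lambda>\<omega>. if R k \<omega> \<noteq> 0 then 1 else 0 :: real)"
    by (rule simple_fun_X_R[of k "\<lambda>x r. if r \<noteq> 0 then 1 else 0"])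
  then have "simple_function (past M I k)
      (\<lambda>\<omega>. rho_prod A B \<alpha> \<theta> (\<lambda>l. R l \<omega>) k * indicator {\<omega>. R k \<omega> \<noteq> 0} \<omega>)"
    using simple_function_mult[OF simple_rho_prod] by (simp add: indicator_def of_bool_def)
  from integrable_simple_past[OF this]
  have "(\<integral>\<omega>. err (Suc k) \<omega> \<partial>M) \<le> (\<integral>\<omega>. rho_prod A B \<alpha> \<theta> (\<lambda>l. R l \<omega>) k
      * indicator {\<omega>. R k \<omega> \<noteq> 0} \<omega> * (norm (X0 - Xs))\<^sup>2 \<partial>M)"
    using err_le_rho_prod by (intro integral_mono_AE integrable_err) auto
  then show ?thesis by simp
qed

end

theorem theorem4p5:
  fixes A :: "real ^ 'p ^ 'm" and B :: "real ^ 'n ^ 'q" and C :: "real ^ 'n ^ 'm"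
    and X0 Xs :: "real ^ 'q ^ 'p" and \<alpha> \<theta> :: real
    and M :: "'a measure" and I :: "nat \<Rightarrow> 'a \<Rightarrow> 'm"
    and X :: "nat \<Rightarrow> 'a \<Rightarrow> real ^ 'q ^ 'p" and R :: "nat \<Rightarrow> 'a \<Rightarrow> real ^ 'n ^ 'm"
  assumes rows: "\<forall>i. A $ i \<noteq> 0" and "B \<noteq> 0"
    and consistent: "\<exists>Y. A ** Y ** B = C"
    and theta: "0 < \<theta>" "\<theta> < 1"
    and alpha: "0 < \<alpha>" "\<alpha> < 2 / (spectral_norm B)\<^sup>2"
    and init: "vec_cols X0 \<in> mat_range (kron B (transpose A))"
    and process: "me_rgrbk A B C \<alpha> \<theta> X0 M I X R"
    and Xs: "Xs = pinv A ** C ** pinv B"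
  shows "(\<forall>Y. least_norm_solution A B C Y \<longleftrightarrow> Y = Xs)
    \<and> (\<lambda>k. \<integral>\<omega>. (norm (X k \<omega> - Xs))\<^sup>2 \<partial>M) \<longlonglongrightarrow> 0
    \<and> (\<integral>\<omega>. (norm (X 1 \<omega> - Xs))\<^sup>2 \<partial>M) \<le> rho0 A B \<alpha> * (norm (X0 - Xs))\<^sup>2
    \<and> (\<forall>k\<ge>1. AE \<omega> in M. R k \<omega> \<noteq> 0 \<longrightarrow>
         real_cond_exp M (past M I k) (\<lambda>\<omega>. (norm (X (Suc k) \<omega> - Xs))\<^sup>2) \<omega>
           \<le> rho A B \<alpha> \<theta> (R k \<omega>) * (norm (X k \<omega> - Xs))\<^sup>2)
    \<and> (\<forall>k. (\<integral>\<omega>. (norm (X (Suc k) \<omega> - Xs))\<^sup>2 \<partial>M)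
           \<le> (\<integral>\<omega>. rho_prod A B \<alpha> \<theta> (\<lambda>l. R l \<omega>) k * indicator {\<omega>. R k \<omega> \<noteq> 0} \<omega> \<partial>M)
               * (norm (X0 - Xs))\<^sup>2)"
proof -
  have "prob_space M" using process by (simp add: me_rgrbk_def)
  interpret rgrbk M A B C X0 Xs \<alpha> \<theta> I X R
  proof (intro rgrbk.intro rgrbk_axioms.intro)
    show "X0 \<in> sandwich_range A B"
      using init by (simp only: vec_cols_in_kron_range_iff)
    show "Xs \<in> sandwich_range A B" unfolding Xs by (rule pinv_sandwich_in_range)
    show "A ** Xs ** B = C" unfolding Xs by (rule pinv_sandwich_solves[OF consistent])
  qed fact+
  show ?thesis
    using least_norm_solution_pinv[OF consistent] \<open>Xs = pinv A ** C ** pinv B\<close> expected_err_tendsto_0 expected_err_1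
      cond_exp_err expected_err_le_rho_prod by blast
qed

end
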